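(* Consider the order-assignment model described in the context. In the case of undersupply, i.e. $N\le b$, the benefit of participation $B(\alpha,\tau):=u^D(\alpha,\tau)-u^A(\alpha,\tau)$ is positive and given by $$B(\alpha,\tau)=\frac{n}{b}(\tau-r)>0 .$$
   Context: Model. Parameters: integers $N\ge1$ (workers) and $b\ge1$ (busy time); reals $r$ (base pay), $\delta>0$ (pay increment), $c,m$ (average cost per mile, average miles per order), $n>0$ (orders per hour); a threshold $\tau\ge r$ such that $\tau-r$ is a multiple of $\delta$, with $Z:=(\tau-r)/\delta$; a fraction $\alpha\in[0,1]$ of the $N$ workers are participants ($\alpha N$ workers), the other $(1-\alpha)N$ are non-participants. Dynamics. Time is discrete, with one incoming order per time step $t$. Each worker is idle or busy. If at least one worker is idle at step $t$, the order is offered, at pay $r$, to a uniformly random idle worker. A non-participant accepts at any pay; a participant accepts iff the current pay is at least $\tau$ and otherwise declines. After each decline the pay rises by $\delta$ and the order is offered again to a random idle worker (possibly the same one), within the same time step, until accepted. A worker accepting the order of step $t$ is busy for $b$ time steps, and is idle again for the order of step $t+b$. If no worker is idle at step $t$, the order of step $t$ is not delivered. Let $I_t=1$ if some worker is idle at step $t$ and $I_t=0$ otherwise. Let $q_t$ be the fraction of participants among the workers idle at step $t$, and let $\beta_t:=q_t^{Z+1}$, the probability (when $I_t=1$) that a participant accepts the order. For $q_t<1$ let $$R_t:=\sum_{z=0}^{Z} z\delta\,\frac{q_t^z(1-q_t)}{1-q_t^{Z+1}},$$ the expected pay increase over $r$ given that a non-participant accepts the order at step $t$; the product $(1-\beta_t)R_t$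 is read as $0$ when $q_t=1$. Any product containing the factor $I_t$ is $0$ when $I_t=0$. $\mathbb{E}_t$ denotes the expectation over time steps (long-run average, with the process in equilibrium). The expected spillover effect is $R:=\mathbb{E}_t[(1-\beta_t)R_tI_t]$. Utilities (expected hourly income per worker), for participants and non-participants respectively (each defined when the corresponding group is nonempty): $$u^D(\alpha,\tau):=\frac{1}{\alpha N}(\tau-cm)\,n\,\mathbb{E}_t[\beta_tI_t],$$ $$u^A(\alpha,\tau):=\frac{1}{(1-\alpha)N}(r-cm)\,n\,\bigl(1-\mathbb{E}_t[\beta_tI_t]\bigr)+\frac{n}{(1-\alpha)N}R .$$
   Formalization: In u^A the factor 1 − E_t[β_t I_t] is replaced by E_t[I_t] − E_t[β_t I_t], since undelivered orders earn nothing and the identity fails as printed when N<b and r≠cm; and B>0 is claimed only for τ>r, since B=0 at τ=r. *)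

theory Defs
  imports "HOL-Probability.Probability"
begin

text \<open>
  The workers are the elements of a finite type \<open>'w\<close>, so that \<open>N = CARD('w)\<close>, and
  \<open>D :: 'w set\<close> is the set of participants. A state \<open>s :: 'w \<Rightarrow> nat\<close>, seen when the order of
  a step arrives, gives for each worker the number of steps until that worker is idle;
  \<open>s w = 0\<close> means that \<open>w\<close> is idle now.
\<close>

definition states :: "nat \<Rightarrow> ('w \<Rightarrow> nat) set" where
  "states b = {s. \<forall>w. s w < b}"

definition idle :: "('w \<Rightarrow> nat) \<Rightarrow> 'w set" where
  "idle s = {w. s w = 0}"

text \<open>
  The worker who finally accepts an order that is currently offered at pay \<open>p\<close> to the idle
  workers \<open>S\<close>. The conjunct \<open>0 < \<delta>\<close> only serves to make the function total.
\<close>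

function offer :: "real \<Rightarrow> real \<Rightarrow> 'w set \<Rightarrow> 'w set \<Rightarrow> real \<Rightarrow> 'w pmf" where
  "offer \<delta> \<tau> D S p =
     bind_pmf (pmf_of_set S)
       (\<lambda>w. if w \<in> D \<and> p < \<tau> \<and> 0 < \<delta> then offer \<delta> \<tau> D S (p + \<delta>) else return_pmf w)"
  by pat_completeness auto
termination
proof (relation "Wellfounded.measure (\<lambda>(\<delta>, \<tau>, D, S, p). nat \<lceil>(\<tau> - p) / \<delta>\<rceil>)")
  fix \<delta> \<tau> p :: real and D S :: "'w set" and w
  assume "w \<in> D \<and> p < \<tau> \<and> 0 < \<delta>"
  then have d: "0 < \<delta>" and "0 < (\<tau> - p) / \<delta>"
    by simp_all
  then have pos: "0 < \<lceil>(\<tau> - p) / \<delta>\<rceil>"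
    by simp
  have "(\<tau> - (p + \<delta>)) / \<delta> = (\<tau> - p) / \<delta> - 1"
    using d by (simp add: field_simps)
  then have "\<lceil>(\<tau> - (p + \<delta>)) / \<delta>\<rceil> = \<lceil>(\<tau> - p) / \<delta>\<rceil> - 1"
    by simp
  with pos show "((\<delta>, \<tau>, D, S, p + \<delta>), (\<delta>, \<tau>, D, S, p))
      \<in> Wellfounded.measure (\<lambda>(\<delta>, \<tau>, D, S, p). nat \<lceil>(\<tau> - p) / \<delta>\<rceil>)"
    by simp
qed simp

declare offer.simps [simp del]

text \<open>
  The worker \<open>a\<close> accepting the order of step \<open>t\<close> has \<open>b - 1\<close> steps left at step \<open>t + 1\<close> and is
  thus idle again at step \<open>t + b\<close>.
\<close>

definition step ::
  "nat \<Rightarrow> real \<Rightarrow> real \<Rightarrow> 'w set \<Rightarrow> real \<Rightarrow> ('w \<Rightarrow> nat) \<Rightarrow> ('w \<Rightarrow> nat) pmf" where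
  "step b r \<delta> D \<tau> s =
     (if idle s = {} then return_pmf (\<lambda>w. s w - 1)
      else map_pmf (\<lambda>a w. if w = a then b - 1 else s w - 1) (offer \<delta> \<tau> D (idle s) r))"

primrec law ::
  "nat \<Rightarrow> real \<Rightarrow> real \<Rightarrow> 'w set \<Rightarrow> ('w \<Rightarrow> nat) pmf \<Rightarrow> real \<Rightarrow> nat \<Rightarrow> ('w \<Rightarrow> nat) pmf" where
  "law b r \<delta> D \<mu> \<tau> 0 = \<mu>"
| "law b r \<delta> D \<mu> \<tau> (Suc t) = bind_pmf (law b r \<delta> D \<mu> \<tau> t) (step b r \<delta> D \<tau>)"

text \<open>
  Expectation over time steps, as the long-run average from the initial law \<open>\<mu>\<close>. For a
  stationary \<open>\<mu>\<close> this is the expectation under \<open>\<mu>\<close>, see \<open>long_run_stationary\<close> below.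
\<close>

definition long_run ::
  "nat \<Rightarrow> real \<Rightarrow> real \<Rightarrow> 'w set \<Rightarrow> ('w \<Rightarrow> nat) pmf \<Rightarrow> real \<Rightarrow> (('w \<Rightarrow> nat) \<Rightarrow> real) \<Rightarrow> real"
  where
  "long_run b r \<delta> D \<mu> \<tau> f =
     lim (\<lambda>T. (\<Sum>t<T. measure_pmf.expectation (law b r \<delta> D \<mu> \<tau> t) f) / real T)"

definition max_rises :: "real \<Rightarrow> real \<Rightarrow> real \<Rightarrow> nat" where
  "max_rises r \<delta> \<tau> = nat \<lfloor>(\<tau> - r) / \<delta>\<rfloor>"

definition served :: "('w \<Rightarrow> nat) \<Rightarrow> real" where
  "served s = (if idle s \<noteq> {} then 1 else 0)"

definition participant_share :: "'w set \<Rightarrow> ('w \<Rightarrow> nat) \<Rightarrow> real" where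
  "participant_share D s = real (card (idle s \<inter> D)) / real (card (idle s))"

definition participant_prob :: "real \<Rightarrow> real \<Rightarrow> 'w set \<Rightarrow> real \<Rightarrow> ('w \<Rightarrow> nat) \<Rightarrow> real" where
  "participant_prob r \<delta> D \<tau> s = participant_share D s ^ (max_rises r \<delta> \<tau> + 1)"

text \<open>For \<open>q = 1\<close> division by zero makes this \<open>0\<close>, but then \<open>1 - participant_prob\<close> is \<open>0\<close> as well.\<close>

definition mean_rise :: "real \<Rightarrow> real \<Rightarrow> 'w set \<Rightarrow> real \<Rightarrow> ('w \<Rightarrow> nat) \<Rightarrow> real" where
  "mean_rise r \<delta> D \<tau> s =
     (let q = participant_share D s; Z = max_rises r \<delta> \<tau>
      in \<Sum>z = 0..Z. real z * \<delta> * (q ^ z * (1 - q) / (1 - q ^ (Z + 1))))"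

definition spillover ::
  "nat \<Rightarrow> real \<Rightarrow> real \<Rightarrow> 'w set \<Rightarrow> ('w \<Rightarrow> nat) pmf \<Rightarrow> real \<Rightarrow> real" where
  "spillover b r \<delta> D \<mu> \<tau> =
     long_run b r \<delta> D \<mu> \<tau> (\<lambda>s. (1 - participant_prob r \<delta> D \<tau> s) * mean_rise r \<delta> D \<tau> s * served s)"

definition u_D ::
  "nat \<Rightarrow> real \<Rightarrow> real \<Rightarrow> real \<Rightarrow> real \<Rightarrow> real \<Rightarrow> 'w::finite set \<Rightarrow> ('w \<Rightarrow> nat) pmf \<Rightarrow>
   real \<Rightarrow> real \<Rightarrow> real" where
  "u_D b r \<delta> c m n D \<mu> \<alpha> \<tau> =
     1 / (\<alpha> * real CARD('w)) * (\<tau> - c * m) * n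
       * long_run b r \<delta> D \<mu> \<tau> (\<lambda>s. participant_prob r \<delta> D \<tau> s * served s)"

text \<open>
  Non-participants deliver the share \<open>E[served] - E[participant_prob * served]\<close> of all
  orders. This is \<open>1 - E[participant_prob * served]\<close> if and only if the long-run share of
  undelivered orders is zero; an undelivered order earns nothing.
\<close>

definition u_A ::
  "nat \<Rightarrow> real \<Rightarrow> real \<Rightarrow> real \<Rightarrow> real \<Rightarrow> real \<Rightarrow> 'w::finite set \<Rightarrow> ('w \<Rightarrow> nat) pmf \<Rightarrow>
   real \<Rightarrow> real \<Rightarrow> real" where
  "u_A b r \<delta> c m n D \<mu> \<alpha> \<tau> =
     1 / ((1 - \<alpha>) * real CARD('w)) * (r - c * m) * n
       * (long_run b r \<delta> D \<mu> \<tau> served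
            - long_run b r \<delta> D \<mu> \<tau> (\<lambda>s. participant_prob r \<delta> D \<tau> s * served s))
     + n / ((1 - \<alpha>) * real CARD('w)) * spillover b r \<delta> D \<mu> \<tau>"

definition benefit ::
  "nat \<Rightarrow> real \<Rightarrow> real \<Rightarrow> real \<Rightarrow> real \<Rightarrow> real \<Rightarrow> 'w::finite set \<Rightarrow> ('w \<Rightarrow> nat) pmf \<Rightarrow>
   real \<Rightarrow> real \<Rightarrow> real" where
  "benefit b r \<delta> c m n D \<mu> \<alpha> \<tau> =
     u_D b r \<delta> c m n D \<mu> \<alpha> \<tau> - u_A b r \<delta> c m n D \<mu> \<alpha> \<tau>"

lemma u_A_all_delivered:
  fixes D :: "'w::finite set"
  assumes "long_run b r \<delta> D \<mu> \<tau> served = 1"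
  shows "u_A b r \<delta> c m n D \<mu> \<alpha> \<tau> =
     1 / ((1 - \<alpha>) * real CARD('w)) * (r - c * m) * n
       * (1 - long_run b r \<delta> D \<mu> \<tau> (\<lambda>s. participant_prob r \<delta> D \<tau> s * served s))
     + n / ((1 - \<alpha>) * real CARD('w)) * spillover b r \<delta> D \<mu> \<tau>"
  by (simp add: u_A_def assms)

lemma long_run_stationary:
  assumes "bind_pmf \<mu> (step b r \<delta> D \<tau>) = \<mu>"
  shows "long_run b r \<delta> D \<mu> \<tau> f = measure_pmf.expectation \<mu> f"
proof -
  have law: "law b r \<delta> D \<mu> \<tau> t = \<mu>" for t
    by (induction t) (simp_all add: assms)
  have "eventually (\<lambda>T. measure_pmf.expectation \<mu> f =
      (\<Sum>t<T. measure_pmf.expectation (law b r \<delta> D \<mu> \<tau> t) f) / real T) sequentially"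
    using eventually_gt_at_top[of 0] by eventually_elim (simp add: law)
  then have "(\<lambda>T. (\<Sum>t<T. measure_pmf.expectation (law b r \<delta> D \<mu> \<tau> t) f) / real T)
      \<longlonglongrightarrow> measure_pmf.expectation \<mu> f"
    by (rule Lim_transform_eventually[OF tendsto_const])
  then show ?thesis
    unfolding long_run_def by (rule limI)
qed

text \<open>The probability that a participant accepts the order is indeed \<open>participant_prob\<close>.\<close>

lemma prob_offer_participants:
  assumes "finite S" "S \<noteq> {}" "0 < \<delta>"
  shows "measure_pmf.prob (offer \<delta> (p + real k * \<delta>) D S p) D
           = (real (card (S \<inter> D)) / real (card S)) ^ (k + 1)"
proof (induction k arbitrary: p)
  case 0
  have "offer \<delta> p D S p = pmf_of_set S"
    by (subst offer.simps) (simp add: bind_return_pmf')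
  then show ?case
    using assms by (simp add: measure_pmf_of_set)
next
  case (Suc k)
  let ?\<tau> = "p + real (Suc k) * \<delta>"
  let ?x = "(real (card (S \<inter> D)) / real (card S)) ^ (k + 1)"
  have lt: "p < ?\<tau>"
    using assms(3) by (simp add: add_nonneg_pos)
  have "?\<tau> = (p + \<delta>) + real k * \<delta>"
    by (simp add: algebra_simps)
  then have IH: "measure_pmf.prob (offer \<delta> ?\<tau> D S (p + \<delta>)) D = ?x"
    using Suc.IH[of "p + \<delta>"] by metis
  have "measure_pmf.prob (offer \<delta> ?\<tau> D S p) D
      = measure_pmf.expectation (pmf_of_set S) (\<lambda>w. measure_pmf.prob
          (if w \<in> D then offer \<delta> ?\<tau> D S (p + \<delta>) else return_pmf w) D)"
    using lt assms(3)
    by (subst offer.simps, unfold measure_pmf_bind,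
        subst measure_pmf.measure_bind[where N = "count_space UNIV"])
       (auto simp: measure_subprob)
  also have "\<dots> = measure_pmf.expectation (pmf_of_set S) (\<lambda>w. ?x * indicator D w)"
  proof (intro Bochner_Integration.integral_cong refl)
    fix w
    show "measure_pmf.prob (if w \<in> D then offer \<delta> ?\<tau> D S (p + \<delta>) else return_pmf w) D
        = ?x * indicator D w"
      by (cases "w \<in> D"; simp only: IH if_True if_False; simp)
  qed
  also have "\<dots> = ?x * (real (card (S \<inter> D)) / real (card S))"
    using assms(1,2) by (simp add: measure_pmf_of_set)
  finally show ?case
    by simp
qed

end

theory Submission
  imports Defs
begin

text \<open>
  After a transient of at most \<open>2 * b\<close> steps no two workers have the same number of steps left:
  workers who have become busy since the start have done so at distinct steps, and if all of
  \<open>b\<close> consecutive orders are delivered, then they are delivered by \<open>b\<close> distinct workers,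
  who are all the workers there are. From then on at most one worker is idle, so the dynamics are
  deterministic, every worker delivers one order in \<open>b\<close> steps, and the spillover vanishes.
  The averages are computed by telescoping the total number of steps left over a set of workers:
  each step changes it by \<open>b\<close> times the number of idle ones minus the number of all of them.
\<close>

section \<open>One-step transitions and the transient phase\<close>

lemma set_offer_subset:
  assumes "finite S" "S \<noteq> {}"
  shows "set_pmf (offer \<delta> \<tau> D S p) \<subseteq> S"
  using assms
proof (induction \<delta> \<tau> D S p rule: offer.induct)
  case (1 \<delta> \<tau> D S p)
  show ?case
  proof
    fix x
    assume "x \<in> set_pmf (offer \<delta> \<tau> D S p)"
    then obtain w where "w \<in> S"
      and x: "x \<in> set_pmf (if w \<in> D \<and> p < \<tau> \<and> 0 < \<delta> then offer \<delta> \<tau> D S (p + \<delta>) else return_pmf w)"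
      using "1.prems" by (subst (asm) offer.simps) auto
    moreover have "set_pmf (offer \<delta> \<tau> D S (p + \<delta>)) \<subseteq> S" if "w \<in> D \<and> p < \<tau> \<and> 0 < \<delta>"
      using "1.IH"[OF _ that] "1.prems" \<open>w \<in> S\<close> by simp
    ultimately show "x \<in> S"
      by (auto split: if_splits)
  qed
qed

text \<open>Of the random offers, the dynamics below need only that the accepting worker is idle;
  the probabilities do not enter.\<close>

lemma step_cases:
  fixes s :: "'w::finite \<Rightarrow> nat"
  assumes "s' \<in> set_pmf (step b r \<delta> D \<tau> s)"
  obtains (none_idle) "\<And>w. s w = Suc (s' w)"
  | (accepts) a where "s a = 0" "s' a = b - 1" "\<And>w. w \<noteq> a \<Longrightarrow> s' w = s w - 1"
proof (cases "idle s = {}")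
  case True
  then show ?thesis
    using assms none_idle by (simp add: step_def idle_def)
next
  case False
  then obtain a where "a \<in> set_pmf (offer \<delta> \<tau> D (idle s) r)"
    and s': "s' = (\<lambda>w. if w = a then b - 1 else s w - 1)"
    using assms by (auto simp: step_def)
  then have "a \<in> idle s"
    using set_offer_subset[OF finite False] by blast
  then show ?thesis
    using accepts s' by (simp add: idle_def)
qed

text \<open>
  The state seen at step \<open>t\<close>: workers with at least \<open>b - t\<close> steps left became busy after the
  start, hence at distinct steps. From step \<open>b\<close> on these are all busy workers, and either an order
  went undelivered, which means that all workers were busy, or all orders since then were delivered.
\<close>

definition transient_invariant :: "nat \<Rightarrow> nat \<Rightarrow> ('w \<Rightarrow> nat) \<Rightarrow> bool" where
  "transient_invariant b t s \<longleftrightarrow> s \<in> states b \<and> inj_on s {w. 0 < s w \<and> b \<le> s w + t}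
     \<and> (b \<le> t \<longrightarrow> inj s \<or> {2 * b - t..<b} \<subseteq> range s)"

lemma step_in_states:
  fixes s :: "'w::finite \<Rightarrow> nat"
  assumes "1 \<le> b" "s \<in> states b" "s' \<in> set_pmf (step b r \<delta> D \<tau> s)"
  shows "s' \<in> states b"
proof -
  have lt: "s w < b" for w
    using assms(2) by (simp add: states_def)
  have "s' w < b" for w
    using assms(3)
  proof (cases rule: step_cases)
    case none_idle
    then show ?thesis
      using lt[of w] by simp
  next
    case (accepts a)
    then show ?thesis
      using lt[of w] assms(1) by (cases "w = a") simp_all
  qed
  then show ?thesis
    by (simp add: states_def)
qed

text \<open>Besides the accepting worker nobody is idle, so all others count down to values below
  \<open>b - 1\<close>, and \<open>b - 1\<close> is free for that worker.\<close>

lemma step_inj: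
  fixes s :: "'w::finite \<Rightarrow> nat"
  assumes "s \<in> states b" "inj s" "s' \<in> set_pmf (step b r \<delta> D \<tau> s)"
  shows "inj s'"
proof (rule injI)
  fix x y
  assume eq: "s' x = s' y"
  show "x = y"
    using assms(3)
  proof (cases rule: step_cases)
    case none_idle
    then show ?thesis
      using eq injD[OF assms(2), of x y] by simp
  next
    case (accepts a)
    have pos: "0 < s w" "s w < b" if "w \<noteq> a" for w
      using that accepts(1) assms(1) injD[OF assms(2), of w a]
      by (simp_all add: states_def) (metis gr0I)
    have below: "s' w < b - 1" if "w \<noteq> a" for w
      using pos[OF that] accepts(3)[OF that] by simp
    show ?thesis
    proof (cases "x = a \<or> y = a")
      case True
      then show ?thesis
        using eq below accepts(2) by (metis less_irrefl)
    next
      case False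
      then have "s x = s y"
        using eq pos[of x] pos[of y] accepts(3)[of x] accepts(3)[of y] by simp
      then show ?thesis
        by (rule injD[OF assms(2)])
    qed
  qed
qed

text \<open>Pigeonhole: at most \<open>b\<close> workers attain \<open>b\<close> values, which
  leaves no room for a collision.\<close>

lemma inj_if_range_full:
  fixes s :: "'w::finite \<Rightarrow> nat"
  assumes "CARD('w) \<le> b" "{0..<b} \<subseteq> range s"
  shows "inj s"
proof -
  have "b \<le> card (range s)"
    using card_mono[OF _ assms(2)] by simp
  moreover have "card (range s) \<le> CARD('w)"
    by (rule card_image_le) simp
  ultimately show ?thesis
    using assms(1) by (intro eq_card_imp_inj_on) auto
qed

text \<open>A newly busy worker gets \<open>b - 1\<close>, above all workers still busy, so
  distinctness persists. For b \<le> t \<le> 2b the interval holds the values of those who accepted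
  at steps b, ..., t - 1: a further acceptance extends it, while a step without idle workers shows
  that the state was already injective.\<close>

lemma transient_invariant_step:
  fixes s :: "'w::finite \<Rightarrow> nat"
  assumes b: "1 \<le> b" "CARD('w) \<le> b"
    and inv: "transient_invariant b t s" and s': "s' \<in> set_pmf (step b r \<delta> D \<tau> s)"
  shows "transient_invariant b (Suc t) s'"
proof -
  have st: "s \<in> states b" and inj: "inj_on s {w. 0 < s w \<and> b \<le> s w + t}"
    and rng: "b \<le> t \<Longrightarrow> inj s \<or> {2 * b - t..<b} \<subseteq> range s"
    using inv by (auto simp: transient_invariant_def)
  have lt: "s w < b" for w
    using st by (simp add: states_def)
  have "inj_on s' {w. 0 < s' w \<and> b \<le> s' w + Suc t}"
  proof (rule inj_onI)
    fix x y
    assume x: "x \<in> {w. 0 < s' w \<and> b \<le> s' w + Suc t}"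
      and y: "y \<in> {w. 0 < s' w \<and> b \<le> s' w + Suc t}" and eq: "s' x = s' y"
    show "x = y"
      using s'
    proof (cases rule: step_cases)
      case none_idle
      then show ?thesis
        using x y eq by (intro inj_onD[OF inj]) simp_all
    next
      case (accepts a)
      \<comment> \<open>Positivity matters for \<open>b = 1\<close>: there an idle worker other than
        \<open>a\<close> stays at 0, which equals \<open>b - 1\<close>.\<close>
      have below: "s' w < b - 1" if "w \<noteq> a" "0 < s' w" for w
        using that(2) lt[of w] accepts(3)[OF that(1)] by simp
      show ?thesis
      proof (cases "x = a \<or> y = a")
        case True
        then show ?thesis
          using x y eq below accepts(2) by (metis (mono_tags) less_irrefl mem_Collect_eq)
      next
        case False
        then have "s x = Suc (s' x)" "s y = Suc (s' y)"
          using x y accepts(3)[of x] accepts(3)[of y] by simp_all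
        then show ?thesis
          using x y eq by (intro inj_onD[OF inj]) simp_all
      qed
    qed
  qed
  moreover have "inj s' \<or> {2 * b - Suc t..<b} \<subseteq> range s'" if "b \<le> Suc t"
  proof (cases "inj s")
    case True
    then show ?thesis
      using step_inj[OF st _ s'] by blast
  next
    case not_inj: False
    show ?thesis
    proof (cases "Suc t = b")
      case True
      \<comment> \<open>The clause comes into force at time \<open>b\<close> with an empty
        interval.\<close>
      then show ?thesis
        by simp
    next
      case False
      then have t: "b \<le> t"
        using that by simp
      then have rng: "{2 * b - t..<b} \<subseteq> range s"
        using rng not_inj by blast
      then have t2: "t < 2 * b"
        using inj_if_range_full[OF b(2)] not_inj by (metis diff_is_0_eq not_less)
      show ?thesis
        using s'
      proof (cases rule: step_cases)
        case none_idle
        \<comment> \<open>Everybody is busy and b \<le> t, so the set on which \<open>s\<close> is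
          known to be injective contains all workers.\<close>
        then have "inj s"
          using inj t by (simp add: trans_le_add2)
        then show ?thesis
          using not_inj by blast
      next
        case (accepts a)
        have "v \<in> range s'" if v: "v \<in> {2 * b - Suc t..<b}" for v
        proof (cases "v = b - 1")
          case True
          then have "v = s' a"
            using accepts(2) by simp
          then show ?thesis
            by blast
        next
          case False
          then have "Suc v \<in> {2 * b - t..<b}"
            using v by auto
          then obtain w where "Suc v = s w"
            using rng by blast
          then have "v = s' w"
            using accepts(1) accepts(3)[of w] by (cases "w = a") simp_all
          then show ?thesis
            by blast
        qed
        then show ?thesis
          by blast
      qed
    qed
  qed
  ultimately show ?thesis
    using step_in_states[OF b(1) st s'] by (simp add: transient_invariant_def)
qed

text \<open>At time \<open>2 * b\<close> the interval of the invariant has grown to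
  \<open>{0..<b}\<close>, so both alternatives give injectivity. The initial law need not be
  stationary.\<close>

lemma law_support:
  fixes \<mu> :: "('w::finite \<Rightarrow> nat) pmf"
  assumes "1 \<le> b" "CARD('w) \<le> b" "set_pmf \<mu> \<subseteq> states b"
    and s: "s \<in> set_pmf (law b r \<delta> D \<mu> \<tau> t)"
  shows "s \<in> states b" and "2 * b \<le> t \<Longrightarrow> inj s"
proof -
  have inv: "transient_invariant b t s"
    using s
  proof (induction t arbitrary: s)
    case 0
    then have "s \<in> states b"
      using assms(3) by auto
    moreover have "{w. 0 < s w \<and> b \<le> s w + 0} = {}"
      using calculation by (simp add: states_def not_le)
    then have "inj_on s {w. 0 < s w \<and> b \<le> s w + 0}"
      by (simp only: inj_on_empty)
    ultimately show ?case
      using assms(1) by (simp add: transient_invariant_def)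
  next
    case (Suc t)
    then obtain s0 where "s0 \<in> set_pmf (law b r \<delta> D \<mu> \<tau> t)" "s \<in> set_pmf (step b r \<delta> D \<tau> s0)"
      by auto
    then show ?case
      using transient_invariant_step[OF assms(1,2) Suc.IH] by blast
  qed
  then show "s \<in> states b"
    by (simp add: transient_invariant_def)
  show "inj s" if "2 * b \<le> t"
  proof -
    have "inj s \<or> {0..<b} \<subseteq> range s"
      using inv that by (simp add: transient_invariant_def)
    then show ?thesis
      using inj_if_range_full[OF assms(2)] by blast
  qed
qed

section \<open>The deterministic regime and its averages\<close>

text \<open>On \<open>states b\<close> this is subtraction of 1 modulo \<open>b\<close>, worker by
  worker.\<close>

definition rotate_state :: "nat \<Rightarrow> ('w \<Rightarrow> nat) \<Rightarrow> 'w \<Rightarrow> nat" where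
  "rotate_state b s = (\<lambda>w. if s w = 0 then b - 1 else s w - 1)"

text \<open>With at most one idle worker, all offers of a step go to the same person, so no
  randomness is left.\<close>

lemma step_inj_state:
  fixes s :: "'w::finite \<Rightarrow> nat"
  assumes "inj s"
  shows "step b r \<delta> D \<tau> s = return_pmf (rotate_state b s)"
proof -
  have "s' = rotate_state b s" if "s' \<in> set_pmf (step b r \<delta> D \<tau> s)" for s'
    using that
  proof (cases rule: step_cases)
    case none_idle
    then show ?thesis
      by (simp add: rotate_state_def)
  next
    case (accepts a)
    have "s w = 0 \<longleftrightarrow> w = a" for w
      using accepts(1) injD[OF assms, of w a] by auto
    then show ?thesis
      using accepts(2,3) by (auto simp: rotate_state_def)
  qed
  then show ?thesis
    by (auto simp: set_pmf_subset_singleton[symmetric])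
qed

lemma sum_rotate_state:
  fixes s :: "'w::finite \<Rightarrow> nat"
  assumes "1 \<le> b"
  shows "(\<Sum>w\<in>A. real (rotate_state b s w))
    = (\<Sum>w\<in>A. real (s w)) + real b * real (card (idle s \<inter> A)) - real (card A)"
proof -
  have "(\<Sum>w\<in>A. real (rotate_state b s w))
      = (\<Sum>w\<in>A. real (s w) + real b * of_bool (w \<in> idle s) - 1)"
    using assms by (intro sum.cong) (auto simp: rotate_state_def idle_def of_nat_diff)
  also have "\<dots> = (\<Sum>w\<in>A. real (s w)) + real b * real (card (idle s \<inter> A)) - real (card A)"
    by (simp add: sum.distrib sum_subtractf sum_distrib_left[symmetric] Int_commute sum.If_cases
        of_bool_def Collect_mem_eq)
  finally show ?thesis .
qed

text \<open>From \<open>T0\<close> on, \<open>a t - l\<close> is an increment of the bounded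
  sequence \<open>G\<close>, so the partial sums stay within a bounded distance of
  \<open>T * l\<close>.\<close>

lemma average_limit_of_telescoping:
  fixes a G :: "nat \<Rightarrow> real"
  assumes tel: "\<And>t. T0 \<le> t \<Longrightarrow> G (Suc t) = G t + a t - l" and bd: "\<And>t. \<bar>G t\<bar> \<le> K"
  shows "(\<lambda>T. (\<Sum>t<T. a t) / real T) \<longlonglongrightarrow> l"
proof -
  \<comment> \<open>Chosen to make the identity below true at \<open>T = T0\<close>; it absorbs the
    transient.\<close>
  define C where "C = (\<Sum>t<T0. a t) - G T0 - real T0 * l"
  have sum: "(\<Sum>t<T. a t) = real T * l + (G T + C)" if "T0 \<le> T" for T
    using that by (induction T rule: dec_induct) (simp_all add: C_def tel algebra_simps)
  have "(\<lambda>T. (G T + C) / real T) \<longlonglongrightarrow> 0"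
  proof (rule tendsto_rabs_zero_cancel, rule tendsto_sandwich)
    show "\<forall>\<^sub>F T in sequentially. 0 \<le> \<bar>(G T + C) / real T\<bar>"
      by simp
    have "\<bar>G T + C\<bar> \<le> K + \<bar>C\<bar>" for T
      using bd[of T] by linarith
    then show "\<forall>\<^sub>F T in sequentially. \<bar>(G T + C) / real T\<bar> \<le> (K + \<bar>C\<bar>) / real T"
      by (simp add: abs_divide divide_right_mono)
  qed (auto intro: lim_const_over_n)
  then have "(\<lambda>T. l + (G T + C) / real T) \<longlonglongrightarrow> l + 0"
    by (intro tendsto_add tendsto_const)
  moreover have "\<forall>\<^sub>F T in sequentially. l + (G T + C) / real T = (\<Sum>t<T. a t) / real T"
    using eventually_gt_at_top[of 0] eventually_ge_at_top[of T0]
    by eventually_elim (simp add: sum field_simps)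
  ultimately show ?thesis
    using Lim_transform_eventually by force
qed

lemma finite_states: "finite (states b :: ('w::finite \<Rightarrow> nat) set)"
proof -
  have "states b = (\<Pi>\<^sub>E w\<in>(UNIV :: 'w set). {..<b})"
    by (auto simp: states_def PiE_def)
  then show ?thesis
    by (simp add: finite_PiE)
qed

text \<open>The condition on \<open>f\<close> concerns injective states only, since the transient
  does not affect the average. The choices \<open>UNIV\<close>, \<open>D\<close> and
  \<open>{}\<close> for \<open>A\<close> yield the delivered share, the participants' share and the
  spillover.\<close>

lemma long_run_undersupply:
  fixes \<mu> :: "('w::finite \<Rightarrow> nat) pmf" and A :: "'w set"
  assumes b: "1 \<le> b" "CARD('w) \<le> b" and \<mu>: "set_pmf \<mu> \<subseteq> states b"
    and f: "\<And>s. s \<in> states b \<Longrightarrow> inj s \<Longrightarrow> f s = real (card (idle s \<inter> A))"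
  shows "long_run b r \<delta> D \<mu> \<tau> f = real (card A) / real b"
proof -
  let ?L = "law b r \<delta> D \<mu> \<tau>"
  \<comment> \<open>The potential for telescoping: after division by \<open>b\<close>, a rotation
    changes it by \<open>f s - card A / b\<close>.\<close>
  define W where "W s = (\<Sum>w\<in>A. real (s w)) / real b" for s :: "'w \<Rightarrow> nat"
  have supp: "set_pmf (?L t) \<subseteq> states b" for t
    using law_support(1)[OF b \<mu>] by blast
  have int: "integrable (measure_pmf (?L t)) g" for t and g :: "('w \<Rightarrow> nat) \<Rightarrow> real"
    by (rule integrable_measure_pmf_finite) (rule finite_subset[OF supp finite_states])
  have tel: "measure_pmf.expectation (?L (Suc t)) W
      = measure_pmf.expectation (?L t) W + measure_pmf.expectation (?L t) f - card A / b"
    if t: "2 * b \<le> t" for t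
  proof -
    have inj: "s \<in> states b" "inj s" if "s \<in> set_pmf (?L t)" for s
      using law_support[OF b \<mu> that] t by simp_all
    have "?L (Suc t) = bind_pmf (?L t) (\<lambda>s. return_pmf (rotate_state b s))"
      using inj by (auto intro!: bind_pmf_cong step_inj_state)
    then have "?L (Suc t) = map_pmf (rotate_state b) (?L t)"
      by (simp add: map_pmf_def)
    then have "measure_pmf.expectation (?L (Suc t)) W
        = measure_pmf.expectation (?L t) (\<lambda>s. W (rotate_state b s))"
      by simp
    also have "\<dots> = measure_pmf.expectation (?L t) (\<lambda>s. W s + f s - card A / b)"
    proof (rule integral_cong_AE)
      have "W (rotate_state b s) = W s + f s - card A / b" if "s \<in> set_pmf (?L t)" for s
        using f[OF inj[OF that]] b(1)
        by (simp add: W_def sum_rotate_state[OF b(1)] field_simps)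
      then show "AE s in measure_pmf (?L t). W (rotate_state b s) = W s + f s - real (card A) / real b"
        by (simp add: AE_measure_pmf_iff)
    qed simp_all
    also have "\<dots> = measure_pmf.expectation (?L t) W + measure_pmf.expectation (?L t) f - card A / b"
      by (simp add: int)
    finally show ?thesis .
  qed
  have bound: "\<bar>measure_pmf.expectation (?L t) W\<bar> \<le> real (card A)" for t
  proof -
    have W: "\<bar>W s\<bar> \<le> real (card A)" if "s \<in> set_pmf (?L t)" for s
    proof -
      have "(\<Sum>w\<in>A. real (s w)) \<le> (\<Sum>w\<in>A. real b)"
        using that supp[of t] by (intro sum_mono) (auto simp: states_def intro: less_imp_le)
      then show ?thesis
        using b(1) by (simp add: W_def abs_divide sum_nonneg field_simps)
    qed
    have "\<bar>measure_pmf.expectation (?L t) W\<bar> \<le> measure_pmf.expectation (?L t) (\<lambda>s. \<bar>W s\<bar>)"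
      by (rule integral_abs_bound)
    also have "\<dots> \<le> measure_pmf.expectation (?L t) (\<lambda>_. real (card A))"
      using W by (intro integral_mono_AE int) (simp add: AE_measure_pmf_iff)
    finally show ?thesis
      by simp
  qed
  show ?thesis
    unfolding long_run_def
    by (rule limI, rule average_limit_of_telescoping
        [where G = "\<lambda>t. measure_pmf.expectation (?L t) W"]) (use tel bound in auto)
qed

section \<open>Delivery rates and the benefit\<close>

text \<open>A single idle worker makes the participant share q equal to 0 or 1, so q^(Z+1) = q for
  every Z. Spillover would need a participant who declines and a non-participant who accepts, hence
  two idle workers.\<close>

lemma inj_state_rates:
  assumes "inj s"
  shows served_inj: "served s = real (card (idle s))"
    and participant_prob_inj: "participant_prob r \<delta> D \<tau> s * served s = real (card (idle s \<inter> D))"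
    and mean_rise_inj: "(1 - participant_prob r \<delta> D \<tau> s) * mean_rise r \<delta> D \<tau> s * served s = 0"
proof -
  have "idle s = {a}" if "s a = 0" for a
    using inj_eq[OF assms, of _ a] that by (simp add: idle_def)
  then consider "idle s = {}" | a where "idle s = {a}"
    unfolding idle_def by blast
  then have "served s = real (card (idle s))
    \<and> participant_prob r \<delta> D \<tau> s * served s = real (card (idle s \<inter> D))
    \<and> (1 - participant_prob r \<delta> D \<tau> s) * mean_rise r \<delta> D \<tau> s * served s = 0"
  proof cases
    case 1
    then show ?thesis
      by (simp add: served_def)
  next
    case (2 a)
    show ?thesis
    proof (cases "a \<in> D")
      case True
      then show ?thesis
        using 2 by (simp add: served_def participant_prob_def participant_share_def)
    next
      case False
      then have q: "participant_share D s = 0"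
        using 2 by (simp add: participant_share_def)
      \<comment> \<open>At \<open>z = 0\<close>, where \<open>0 ^ 0 = 1\<close>, the factor
        \<open>real z\<close> removes the term.\<close>
      have "real z * \<delta> * (0 ^ z * (1 - 0) / (1 - 0 ^ (Z + 1))) = 0" for z Z :: nat
        by (cases z) simp_all
      then have "mean_rise r \<delta> D \<tau> s = 0"
        unfolding mean_rise_def q Let_def by (simp only: sum.neutral_const)
      then show ?thesis
        using 2 False q by (simp add: served_def participant_prob_def)
    qed
  qed
  then show "served s = real (card (idle s))"
    and "participant_prob r \<delta> D \<tau> s * served s = real (card (idle s \<inter> D))"
    and "(1 - participant_prob r \<delta> D \<tau> s) * mean_rise r \<delta> D \<tau> s * served s = 0"
    by blast+
qed

theorem theorem3:
  fixes b :: nat and r \<delta> c m n \<alpha> \<tau> :: real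
    and D :: "'w::finite set" and \<mu> :: "('w \<Rightarrow> nat) pmf"
  assumes "1 \<le> b" and "0 < \<delta>" and "0 < n"
    and "r \<le> \<tau>" and "(\<tau> - r) / \<delta> \<in> \<int>"
    and "0 < \<alpha>" and "\<alpha> < 1" and "real (card D) = \<alpha> * real CARD('w)"
    and "set_pmf \<mu> \<subseteq> states b"
    and undersupply: "CARD('w) \<le> b"
  shows "benefit b r \<delta> c m n D \<mu> \<alpha> \<tau> = n / real b * (\<tau> - r)
    \<and> (r < \<tau> \<longrightarrow> 0 < benefit b r \<delta> c m n D \<mu> \<alpha> \<tau>)"
proof -
  define N where "N = real CARD('w)"
  have N: "0 < N"
    by (simp add: N_def)
  note long_run = long_run_undersupply[OF \<open>1 \<le> b\<close> undersupply \<open>set_pmf \<mu> \<subseteq> states b\<close>]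
  have served: "long_run b r \<delta> D \<mu> \<tau> served = N / b"
    unfolding N_def by (rule long_run) (simp add: served_inj)
  have participants:
    "long_run b r \<delta> D \<mu> \<tau> (\<lambda>s. participant_prob r \<delta> D \<tau> s * served s) = \<alpha> * N / b"
    unfolding N_def assms(8)[symmetric] by (rule long_run) (rule participant_prob_inj)
  \<comment> \<open>The integrand vanishes on injective states, which is the count for the empty set
    of workers.\<close>
  have "spillover b r \<delta> D \<mu> \<tau> = real (card ({} :: 'w set)) / b"
    unfolding spillover_def by (rule long_run) (simp only: mean_rise_inj Int_empty_right card.empty of_nat_0)
  then have spill: "spillover b r \<delta> D \<mu> \<tau> = 0"
    by simp
  have "u_D b r \<delta> c m n D \<mu> \<alpha> \<tau> = (\<tau> - c * m) * n / b"
    using N \<open>0 < \<alpha>\<close> by (simp add: u_D_def participants N_def[symmetric])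
  moreover have "u_A b r \<delta> c m n D \<mu> \<alpha> \<tau> = (r - c * m) * n / b"
  proof -
    \<comment> \<open>Only the share N / b of all orders is delivered; this is what the participants
      leave of it.\<close>
    have "N / b - \<alpha> * N / b = (1 - \<alpha>) * N / b"
      by (simp add: diff_divide_distrib left_diff_distrib)
    then show ?thesis
      using N \<open>\<alpha> < 1\<close> by (simp add: u_A_def served participants spill N_def[symmetric])
  qed
  ultimately have "benefit b r \<delta> c m n D \<mu> \<alpha> \<tau> = n / real b * (\<tau> - r)"
    by (simp add: benefit_def diff_divide_distrib[symmetric] algebra_simps)
  then show ?thesis
    using \<open>1 \<le> b\<close> \<open>0 < n\<close> by simp
qed

end
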